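(* Let $T$ be a finite uniform dyadic tree of depth $N$, and let $\mu=\{\mu_P\}_{P\in T}$ be a collection of non-negative numbers (a measure on $T$). The Hardy operator $I$, $(I\varphi)(\alpha)=\sum_{\beta\ge\alpha}\varphi(\beta)$, is bounded as an operator $I:\ell^2(T)\to\ell^2(T,\mu)$, i.e. $$\sum_{\alpha\in T}\big((I\varphi)(\alpha)\big)^2\mu_\alpha\le C\sum_{\beta\in T}\varphi(\beta)^2\qquad\text{for all }\varphi:T\to\mathbb{R},$$ if and only if $$\sum_{Q\in T,\ Q\le R}\Big(\sum_{P\le Q}\mu_P\Big)^2\le C'\sum_{Q\le R}\mu_Q\qquad\text{for all }R\in T.$$ Here the equivalence is understood with constants uniform in $N$ and $\mu$: if the first inequality holds with constant $C$, then the second holds with a constant $C'$ depending only on $C$; and if the second holds with constant $C'$, then the first holds with a constant $C$ depending only on $C'$.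
   Context: The vertices of $T$ correspond to the dyadic subintervals of a unit interval $I^0$ of length at least $2^{-N}$ (i.e. of generations $0,1,\dots,N$). The order on $T$ is $P\le Q$ if and only if the dyadic interval of $P$ is contained in the dyadic interval of $Q$ (so the root $I^0$ is the largest element). $\ell^2(T)$ is the space of real functions on $T$ with norm squared $\sum_{\beta\in T}\varphi(\beta)^2$, and $\ell^2(T,\mu)$ has norm squared $\sum_{\alpha\in T}\varphi(\alpha)^2\mu_\alpha$. The measure $\mu$ may charge any vertices of $T$, not only the leaves. *)

theory Defs
  imports Complex_Main
begin

text \<open>The tree is realized on the unit interval \<open>[0,1)\<close>, and its vertices are the dyadic intervals
  themselves, so that the order on the tree is inclusion of sets of reals and the root is the
  largest element. Taking the intervals half-open is only a convention.\<close>

definition dyadic_interval :: "nat \<Rightarrow> nat \<Rightarrow> real set" where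
  "dyadic_interval k j = {real j / 2 ^ k ..< real (j + 1) / 2 ^ k}"

definition dyadic_tree :: "nat \<Rightarrow> real set set" where
  "dyadic_tree N = {dyadic_interval k j | k j. k \<le> N \<and> j < 2 ^ k}"

text \<open>Functions on the tree are represented by total functions on sets of reals, whose values
  outside the tree never enter any of the sums below.\<close>

definition hardy :: "nat \<Rightarrow> (real set \<Rightarrow> real) \<Rightarrow> real set \<Rightarrow> real" where
  "hardy N \<phi> \<alpha> = (\<Sum>\<beta> \<in> {\<beta> \<in> dyadic_tree N. \<alpha> \<subseteq> \<beta>}. \<phi> \<beta>)"

definition tree_measure :: "nat \<Rightarrow> (real set \<Rightarrow> real) \<Rightarrow> bool" where
  "tree_measure N \<mu> \<longleftrightarrow> (\<forall>P \<in> dyadic_tree N. 0 \<le> \<mu> P)"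

text \<open>Boundedness of the Hardy operator from \<open>\<ell>\<^sup>2(T)\<close> to \<open>\<ell>\<^sup>2(T, \<mu>)\<close>;
  \<open>C\<close> bounds the square of the operator norm.\<close>

definition hardy_bounded :: "nat \<Rightarrow> (real set \<Rightarrow> real) \<Rightarrow> real \<Rightarrow> bool" where
  "hardy_bounded N \<mu> C \<longleftrightarrow>
     (\<forall>\<phi> :: real set \<Rightarrow> real.
        (\<Sum>\<alpha> \<in> dyadic_tree N. (hardy N \<phi> \<alpha>)\<^sup>2 * \<mu> \<alpha>) \<le> C * (\<Sum>\<beta> \<in> dyadic_tree N. (\<phi> \<beta>)\<^sup>2))"

definition carleson_condition :: "nat \<Rightarrow> (real set \<Rightarrow> real) \<Rightarrow> real \<Rightarrow> bool" where
  "carleson_condition N \<mu> C' \<longleftrightarrow>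
     (\<forall>R \<in> dyadic_tree N.
        (\<Sum>Q \<in> {Q \<in> dyadic_tree N. Q \<subseteq> R}. (\<Sum>P \<in> {P \<in> dyadic_tree N. P \<subseteq> Q}. \<mu> P)\<^sup>2)
          \<le> C' * (\<Sum>Q \<in> {Q \<in> dyadic_tree N. Q \<subseteq> R}. \<mu> Q))"

end

theory Submission
  imports Defs "HOL-Analysis.Convex"
begin

text \<open>
  Write \<open>m(\<beta>)\<close> for the mass of \<open>{\<alpha>. \<alpha> \<le> \<beta>}\<close>.

  Boundedness implies the Carleson condition: test the operator on \<open>m\<close> restricted to the part of
  the tree below \<open>R\<close> and use Cauchy--Schwarz.

  Conversely let \<open>\<phi> \<ge> 0\<close>. The elements above \<open>\<alpha>\<close> form a chain, so
  \<open>(I\<phi>)\<^sup>2 = Iv\<close> with \<open>v = \<phi> (2 I\<phi> - \<phi>)\<close> and \<open>0 \<le> v \<le> 2 \<phi> I\<phi>\<close>. Put \<open>X = \<Sum> (I\<phi>)\<^sup>2 \<mu>\<close>.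
  Exchanging sums, \<open>X = \<Sum> v m \<le> 2 \<Sum> \<phi> I\<phi> m\<close>, so \<open>X\<^sup>2 \<le> 4 (\<Sum> \<phi>\<^sup>2) (\<Sum> (I\<phi>)\<^sup>2 m\<^sup>2)\<close>; and, again
  exchanging sums in \<open>\<Sum> (Iv) m\<^sup>2\<close>, the Carleson condition gives
  \<open>\<Sum> (I\<phi>)\<^sup>2 m\<^sup>2 \<le> C' \<Sum> v m = C' X\<close>. Hence \<open>X \<le> 4 C' \<Sum> \<phi>\<^sup>2\<close>.
\<close>

section \<open>Summation along chains and the Hardy operator on a finite forest\<close>

text \<open>In a chain every pair (\<beta>, \<gamma>) is comparable, so the square is the sum over
  \<beta> \<le> \<gamma> plus the sum over \<gamma> \<le> \<beta> minus the diagonal, which was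
  counted twice. By symmetry both halves equal \<open>L\<close>.\<close>

lemma sum_chain_square:
  fixes \<phi> :: "'a::order \<Rightarrow> real"
  assumes "finite A" and chain: "\<And>\<beta> \<gamma>. \<beta> \<in> A \<Longrightarrow> \<gamma> \<in> A \<Longrightarrow> \<beta> \<le> \<gamma> \<or> \<gamma> \<le> \<beta>"
  shows "(\<Sum>\<beta>\<in>A. \<phi> \<beta>)\<^sup>2 = (\<Sum>\<beta>\<in>A. \<phi> \<beta> * (2 * (\<Sum>\<gamma> | \<gamma> \<in> A \<and> \<beta> \<le> \<gamma>. \<phi> \<gamma>) - \<phi> \<beta>))"
proof -
  define L where "L = (\<Sum>\<beta>\<in>A. \<Sum>\<gamma>\<in>A. if \<beta> \<le> \<gamma> then \<phi> \<beta> * \<phi> \<gamma> else 0)"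
  have L': "(\<Sum>\<beta>\<in>A. \<Sum>\<gamma>\<in>A. if \<gamma> \<le> \<beta> then \<phi> \<beta> * \<phi> \<gamma> else 0) = L"
    unfolding L_def by (subst sum.swap) (intro sum.cong refl, auto)
  have "(\<Sum>\<beta>\<in>A. \<phi> \<beta>)\<^sup>2 = (\<Sum>\<beta>\<in>A. \<Sum>\<gamma>\<in>A. \<phi> \<beta> * \<phi> \<gamma>)"
    by (simp add: power2_eq_square sum_product)
  also have "\<dots> = (\<Sum>\<beta>\<in>A. \<Sum>\<gamma>\<in>A. (if \<beta> \<le> \<gamma> then \<phi> \<beta> * \<phi> \<gamma> else 0)
      + (if \<gamma> \<le> \<beta> then \<phi> \<beta> * \<phi> \<gamma> else 0) - (if \<beta> = \<gamma> then \<phi> \<beta> * \<phi> \<gamma> else 0))"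
    using chain by (intro sum.cong refl) (auto dest: order.antisym)
  also have "\<dots> = 2 * L - (\<Sum>\<beta>\<in>A. \<phi> \<beta> * \<phi> \<beta>)"
    using \<open>finite A\<close> L' by (simp add: sum.distrib sum_subtractf flip: L_def)
  also have "L = (\<Sum>\<beta>\<in>A. \<phi> \<beta> * (\<Sum>\<gamma> | \<gamma> \<in> A \<and> \<beta> \<le> \<gamma>. \<phi> \<gamma>))"
    unfolding L_def using \<open>finite A\<close>
    by (simp add: sum_distrib_left sum.inter_filter if_distrib cong: if_cong)
  finally show ?thesis
    by (simp add: sum_distrib_left sum_subtractf right_diff_distrib mult.left_commute)
qed

text \<open>The estimates are carried out for any finite order with chains above its elements, so
  their constants cannot depend on the depth of the tree.\<close>

locale finite_forest =
  fixes T :: "'a::order set"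
  assumes finite_T: "finite T"
    and above_chain: "\<And>\<alpha> \<beta> \<gamma>. \<alpha> \<in> T \<Longrightarrow> \<beta> \<in> T \<Longrightarrow> \<gamma> \<in> T \<Longrightarrow> \<alpha> \<le> \<beta> \<Longrightarrow> \<alpha> \<le> \<gamma> \<Longrightarrow> \<beta> \<le> \<gamma> \<or> \<gamma> \<le> \<beta>"
begin

definition sum_above :: "('a \<Rightarrow> real) \<Rightarrow> 'a \<Rightarrow> real" where
  "sum_above \<phi> \<alpha> = (\<Sum>\<beta> | \<beta> \<in> T \<and> \<alpha> \<le> \<beta>. \<phi> \<beta>)"

text \<open>The adjoint of the Hardy operator \<open>sum_above\<close> for the counting inner
  product on \<open>T\<close>.\<close>

definition sum_below :: "('a \<Rightarrow> real) \<Rightarrow> 'a \<Rightarrow> real" where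
  "sum_below \<phi> \<beta> = (\<Sum>\<alpha> | \<alpha> \<in> T \<and> \<alpha> \<le> \<beta>. \<phi> \<alpha>)"

lemma sum_above_adjoint:
  "(\<Sum>\<alpha>\<in>T. sum_above \<phi> \<alpha> * \<psi> \<alpha>) = (\<Sum>\<beta>\<in>T. \<phi> \<beta> * sum_below \<psi> \<beta>)"
  unfolding sum_above_def sum_below_def sum_distrib_left sum_distrib_right
  by (rule sum.swap_restrict[OF finite_T finite_T])

text \<open>Whatever lies above some \<beta> \<ge> \<alpha> also lies above \<alpha>. Hence the
  inner sums over the chain above \<alpha> are full values of \<open>sum_above\<close>, and the
  summand no longer depends on \<alpha>.\<close>

lemma sum_above_square:
  assumes "\<alpha> \<in> T"
  shows "(sum_above \<phi> \<alpha>)\<^sup>2 = sum_above (\<lambda>\<beta>. \<phi> \<beta> * (2 * sum_above \<phi> \<beta> - \<phi> \<beta>)) \<alpha>"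
proof -
  let ?A = "{\<beta> \<in> T. \<alpha> \<le> \<beta>}"
  have "(\<Sum>\<beta>\<in>?A. \<phi> \<beta>)\<^sup>2 = (\<Sum>\<beta>\<in>?A. \<phi> \<beta> * (2 * (\<Sum>\<gamma> | \<gamma> \<in> ?A \<and> \<beta> \<le> \<gamma>. \<phi> \<gamma>) - \<phi> \<beta>))"
    using finite_T above_chain[OF assms] by (intro sum_chain_square) auto
  also have "\<dots> = (\<Sum>\<beta>\<in>?A. \<phi> \<beta> * (2 * sum_above \<phi> \<beta> - \<phi> \<beta>))"
  proof (rule sum.cong[OF refl])
    fix \<beta> assume "\<beta> \<in> ?A"
    then have "{\<gamma> \<in> ?A. \<beta> \<le> \<gamma>} = {\<gamma> \<in> T. \<beta> \<le> \<gamma>}"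
      by (auto intro: order.trans)
    then show "\<phi> \<beta> * (2 * (\<Sum>\<gamma> | \<gamma> \<in> ?A \<and> \<beta> \<le> \<gamma>. \<phi> \<gamma>) - \<phi> \<beta>)
        = \<phi> \<beta> * (2 * sum_above \<phi> \<beta> - \<phi> \<beta>)"
      unfolding sum_above_def by simp
  qed
  finally show ?thesis
    unfolding sum_above_def .
qed

section \<open>The two implications on a finite forest\<close>

lemma carleson_if_bounded:
  assumes \<mu>: "\<And>\<alpha>. \<alpha> \<in> T \<Longrightarrow> 0 \<le> \<mu> \<alpha>" and "0 \<le> C"
    and bounded: "\<And>\<phi>. (\<Sum>\<alpha>\<in>T. (sum_above \<phi> \<alpha>)\<^sup>2 * \<mu> \<alpha>) \<le> C * (\<Sum>\<beta>\<in>T. (\<phi> \<beta>)\<^sup>2)"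
  shows "sum_below (\<lambda>\<beta>. (sum_below \<mu> \<beta>)\<^sup>2) \<rho> \<le> C * sum_below \<mu> \<rho>"
proof -
  let ?D = "{\<alpha> \<in> T. \<alpha> \<le> \<rho>}"
  define \<phi> where "\<phi> \<beta> = (if \<beta> \<le> \<rho> then sum_below \<mu> \<beta> else 0)" for \<beta>
  define S where "S = sum_below (\<lambda>\<beta>. (sum_below \<mu> \<beta>)\<^sup>2) \<rho>"
  have S_eq: "(\<Sum>\<beta>\<in>T. (\<phi> \<beta>)\<^sup>2) = S"
    unfolding S_def sum_below_def[of _ \<rho>] sum.inter_filter[OF finite_T]
    by (intro sum.cong) (auto simp: \<phi>_def)
  have m_nonneg: "0 \<le> sum_below \<mu> \<rho>"
    unfolding sum_below_def using \<mu> by (auto intro: sum_nonneg)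
  have "S = (\<Sum>\<beta>\<in>T. \<phi> \<beta> * sum_below \<mu> \<beta>)"
    unfolding S_eq[symmetric] by (intro sum.cong) (auto simp: \<phi>_def power2_eq_square)
  also have "\<dots> = (\<Sum>\<alpha>\<in>T. sum_above \<phi> \<alpha> * \<mu> \<alpha>)"
    by (rule sum_above_adjoint[symmetric])
  \<comment> \<open>If \<alpha> is not below \<rho>, then nothing above \<alpha> is, so \<phi>
    vanishes on all of it.\<close>
  also have "\<dots> = (\<Sum>\<alpha>\<in>?D. sum_above \<phi> \<alpha> * \<mu> \<alpha>)"
  proof (rule sum.mono_neutral_right[OF finite_T])
    have "\<phi> \<beta> = 0" if "\<not> \<alpha> \<le> \<rho>" "\<alpha> \<le> \<beta>" for \<alpha> \<beta>
      using that order.trans by (auto simp: \<phi>_def)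
    then show "\<forall>\<alpha>\<in>T - ?D. sum_above \<phi> \<alpha> * \<mu> \<alpha> = 0"
      unfolding sum_above_def by (auto intro!: sum.neutral)
  qed auto
  \<comment> \<open>Splitting the weight evenly makes the second Cauchy-Schwarz factor the mass
    below \<rho>.\<close>
  also have "\<dots> = (\<Sum>\<alpha>\<in>?D. (sum_above \<phi> \<alpha> * sqrt (\<mu> \<alpha>)) * sqrt (\<mu> \<alpha>))"
    using \<mu> by (intro sum.cong) (auto simp: mult.assoc)
  finally have "S\<^sup>2 = (\<Sum>\<alpha>\<in>?D. (sum_above \<phi> \<alpha> * sqrt (\<mu> \<alpha>)) * sqrt (\<mu> \<alpha>))\<^sup>2"
    by simp
  also have "\<dots> \<le> (\<Sum>\<alpha>\<in>?D. (sum_above \<phi> \<alpha> * sqrt (\<mu> \<alpha>))\<^sup>2) * (\<Sum>\<alpha>\<in>?D. (sqrt (\<mu> \<alpha>))\<^sup>2)"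
    by (rule Cauchy_Schwarz_ineq_sum)
  also have "\<dots> = (\<Sum>\<alpha>\<in>?D. (sum_above \<phi> \<alpha>)\<^sup>2 * \<mu> \<alpha>) * sum_below \<mu> \<rho>"
    unfolding sum_below_def using \<mu>
    by (intro arg_cong2[where f = "(*)"] sum.cong) (auto simp: power_mult_distrib)
  also have "\<dots> \<le> (C * S) * sum_below \<mu> \<rho>"
  proof (rule mult_right_mono[OF _ m_nonneg])
    have "(\<Sum>\<alpha>\<in>?D. (sum_above \<phi> \<alpha>)\<^sup>2 * \<mu> \<alpha>) \<le> (\<Sum>\<alpha>\<in>T. (sum_above \<phi> \<alpha>)\<^sup>2 * \<mu> \<alpha>)"
      using \<mu> finite_T by (intro sum_mono2) auto
    then show "(\<Sum>\<alpha>\<in>?D. (sum_above \<phi> \<alpha>)\<^sup>2 * \<mu> \<alpha>) \<le> C * S"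
      using bounded[of \<phi>] S_eq by simp
  qed
  finally have "S * S \<le> S * (C * sum_below \<mu> \<rho>)"
    by (simp add: power2_eq_square algebra_simps)
  moreover have "0 \<le> S"
    unfolding S_eq[symmetric] by (intro sum_nonneg) simp
  \<comment> \<open>One factor \<open>S\<close> cancels; if \<open>S = 0\<close>, the right-hand
    side is nonnegative anyway.\<close>
  ultimately have "S \<le> C * sum_below \<mu> \<rho>"
    using m_nonneg \<open>0 \<le> C\<close> by (cases "S = 0") auto
  then show ?thesis
    unfolding S_def .
qed

lemma bounded_if_carleson_nonneg:
  assumes \<mu>: "\<And>\<alpha>. \<alpha> \<in> T \<Longrightarrow> 0 \<le> \<mu> \<alpha>" and "0 \<le> C"
    and carleson: "\<And>\<rho>. \<rho> \<in> T \<Longrightarrow> sum_below (\<lambda>\<beta>. (sum_below \<mu> \<beta>)\<^sup>2) \<rho> \<le> C * sum_below \<mu> \<rho>"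
    and \<phi>: "\<And>\<beta>. \<beta> \<in> T \<Longrightarrow> 0 \<le> \<phi> \<beta>"
  shows "(\<Sum>\<alpha>\<in>T. (sum_above \<phi> \<alpha>)\<^sup>2 * \<mu> \<alpha>) \<le> 4 * C * (\<Sum>\<beta>\<in>T. (\<phi> \<beta>)\<^sup>2)"
proof -
  define m where "m = sum_below \<mu>"
  define v where "v \<beta> = \<phi> \<beta> * (2 * sum_above \<phi> \<beta> - \<phi> \<beta>)" for \<beta>
  define X where "X = (\<Sum>\<alpha>\<in>T. (sum_above \<phi> \<alpha>)\<^sup>2 * \<mu> \<alpha>)"
  define P where "P = (\<Sum>\<beta>\<in>T. (\<phi> \<beta>)\<^sup>2)"
  have m_nonneg: "0 \<le> m \<beta>" for \<beta>
    unfolding m_def sum_below_def using \<mu> by (auto intro: sum_nonneg)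
  \<comment> \<open>This gives \<open>v\<close> its sign, so that the Carleson inequalities can be
    summed with the weights \<open>v \<beta>\<close>.\<close>
  have above_ge: "\<phi> \<beta> \<le> sum_above \<phi> \<beta>" if "\<beta> \<in> T" for \<beta>
    unfolding sum_above_def using that finite_T \<phi> by (intro member_le_sum) auto
  have v_nonneg: "0 \<le> v \<beta>" if "\<beta> \<in> T" for \<beta>
    using above_ge[OF that] \<phi>[OF that] by (simp add: v_def)
  have v_le: "v \<beta> \<le> 2 * \<phi> \<beta> * sum_above \<phi> \<beta>" for \<beta>
    by (simp add: v_def algebra_simps)
  have square: "(sum_above \<phi> \<alpha>)\<^sup>2 = sum_above v \<alpha>" if "\<alpha> \<in> T" for \<alpha>
    unfolding v_def by (rule sum_above_square[OF that])
  have X_eq: "X = (\<Sum>\<beta>\<in>T. v \<beta> * m \<beta>)"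
    unfolding X_def m_def by (simp add: square sum_above_adjoint)
  have "(\<Sum>\<beta>\<in>T. (sum_above \<phi> \<beta> * m \<beta>)\<^sup>2) = (\<Sum>\<beta>\<in>T. sum_above v \<beta> * (m \<beta>)\<^sup>2)"
    by (intro sum.cong) (auto simp: power_mult_distrib square)
  also have "\<dots> = (\<Sum>\<beta>\<in>T. v \<beta> * sum_below (\<lambda>\<beta>. (m \<beta>)\<^sup>2) \<beta>)"
    by (rule sum_above_adjoint)
  also have "\<dots> \<le> (\<Sum>\<beta>\<in>T. v \<beta> * (C * m \<beta>))"
    using carleson v_nonneg unfolding m_def by (intro sum_mono mult_left_mono) auto
  also have "\<dots> = C * X"
    by (simp add: X_eq sum_distrib_left mult.left_commute)
  finally have carleson_sum: "(\<Sum>\<beta>\<in>T. (sum_above \<phi> \<beta> * m \<beta>)\<^sup>2) \<le> C * X" .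
  have X_nonneg: "0 \<le> X"
    unfolding X_def using \<mu> by (auto intro: sum_nonneg)
  have P_nonneg: "0 \<le> P"
    unfolding P_def by (intro sum_nonneg) simp
  have "X \<le> (\<Sum>\<beta>\<in>T. 2 * \<phi> \<beta> * sum_above \<phi> \<beta> * m \<beta>)"
    unfolding X_eq using v_le m_nonneg by (intro sum_mono mult_right_mono) auto
  also have "\<dots> = 2 * (\<Sum>\<beta>\<in>T. \<phi> \<beta> * (sum_above \<phi> \<beta> * m \<beta>))"
    by (simp add: sum_distrib_left mult.assoc)
  finally have "X\<^sup>2 \<le> (2 * (\<Sum>\<beta>\<in>T. \<phi> \<beta> * (sum_above \<phi> \<beta> * m \<beta>)))\<^sup>2"
    using X_nonneg by (rule power_mono)
  also have "\<dots> = 4 * (\<Sum>\<beta>\<in>T. \<phi> \<beta> * (sum_above \<phi> \<beta> * m \<beta>))\<^sup>2"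
    by (simp add: power_mult_distrib)
  also have "\<dots> \<le> 4 * (P * (\<Sum>\<beta>\<in>T. (sum_above \<phi> \<beta> * m \<beta>)\<^sup>2))"
    unfolding P_def using Cauchy_Schwarz_ineq_sum by (intro mult_left_mono) auto
  also have "\<dots> \<le> 4 * (P * (C * X))"
    using carleson_sum P_nonneg by (intro mult_left_mono) auto
  finally have "X * X \<le> X * (4 * C * P)"
    by (simp add: power2_eq_square algebra_simps)
  \<comment> \<open>\<open>X\<close> bounds itself: being a finite sum, it can be cancelled from
    both sides unless it is zero.\<close>
  then have "X \<le> 4 * C * P"
    using X_nonneg P_nonneg \<open>0 \<le> C\<close> by (cases "X = 0") auto
  then show ?thesis
    unfolding X_def P_def .
qed

text \<open>Replacing \<phi> by its absolute value keeps the sum of squares and can only increase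
  the square of \<open>sum_above \<phi>\<close> at each vertex, which reduces the claim to
  nonnegative functions.\<close>

lemma bounded_if_carleson:
  assumes \<mu>: "\<And>\<alpha>. \<alpha> \<in> T \<Longrightarrow> 0 \<le> \<mu> \<alpha>" and "0 \<le> C"
    and carleson: "\<And>\<rho>. \<rho> \<in> T \<Longrightarrow> sum_below (\<lambda>\<beta>. (sum_below \<mu> \<beta>)\<^sup>2) \<rho> \<le> C * sum_below \<mu> \<rho>"
  shows "(\<Sum>\<alpha>\<in>T. (sum_above \<phi> \<alpha>)\<^sup>2 * \<mu> \<alpha>) \<le> 4 * C * (\<Sum>\<beta>\<in>T. (\<phi> \<beta>)\<^sup>2)"
proof -
  have "(sum_above \<phi> \<alpha>)\<^sup>2 \<le> (sum_above (\<lambda>\<beta>. \<bar>\<phi> \<beta>\<bar>) \<alpha>)\<^sup>2" for \<alpha>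
    unfolding sum_above_def by (rule abs_le_square_iff[THEN iffD1]) (auto intro: order.trans[OF sum_abs])
  then have "(\<Sum>\<alpha>\<in>T. (sum_above \<phi> \<alpha>)\<^sup>2 * \<mu> \<alpha>)
      \<le> (\<Sum>\<alpha>\<in>T. (sum_above (\<lambda>\<beta>. \<bar>\<phi> \<beta>\<bar>) \<alpha>)\<^sup>2 * \<mu> \<alpha>)"
    using \<mu> by (intro sum_mono mult_right_mono) auto
  also have "\<dots> \<le> 4 * C * (\<Sum>\<beta>\<in>T. \<bar>\<phi> \<beta>\<bar>\<^sup>2)"
    using assms by (intro bounded_if_carleson_nonneg) auto
  finally show ?thesis
    by simp
qed

end

section \<open>Dyadic intervals as a forest\<close>

text \<open>On the finer scale \<open>2 ^ l\<close> all four endpoints become integers, and the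
  common point \<open>x\<close> compares them strictly up to one unit.\<close>

lemma dyadic_interval_subset:
  assumes x: "x \<in> dyadic_interval k j" "x \<in> dyadic_interval l i" and "k \<le> l"
  shows "dyadic_interval l i \<subseteq> dyadic_interval k j"
proof -
  obtain d where l: "l = k + d"
    using \<open>k \<le> l\<close> le_iff_add by blast
  have bounds: "real j \<le> x * 2 ^ k" "x * 2 ^ k < real (j + 1)"
      "real i \<le> x * 2 ^ k * 2 ^ d" "x * 2 ^ k * 2 ^ d < real (i + 1)"
    using x by (simp_all add: dyadic_interval_def l power_add field_simps)
  have "real j * 2 ^ d \<le> x * 2 ^ k * 2 ^ d" "x * 2 ^ k * 2 ^ d < real (j + 1) * 2 ^ d"
    using bounds(1,2) by simp_all
  with bounds(3,4) have "real j * 2 ^ d < real (i + 1)" "real i < real (j + 1) * 2 ^ d"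
    by linarith+
  then have "real (j * 2 ^ d) < real (i + 1)" "real i < real ((j + 1) * 2 ^ d)"
    by (simp_all add: algebra_simps)
  \<comment> \<open>Integrality turns the strict inequalities into the weak ones that inclusion
    requires.\<close>
  then have "j * 2 ^ d \<le> i" "i + 1 \<le> (j + 1) * 2 ^ d"
    unfolding of_nat_less_iff by simp_all
  then have "real (j * 2 ^ d) \<le> real i" "real (i + 1) \<le> real ((j + 1) * 2 ^ d)"
    unfolding of_nat_le_iff by blast+
  moreover have "real j / 2 ^ k = real (j * 2 ^ d) / 2 ^ l"
      "real (j + 1) / 2 ^ k = real ((j + 1) * 2 ^ d) / 2 ^ l"
    by (simp_all only: l power_add of_nat_mult of_nat_power of_nat_numeral) simp_all
  ultimately have "real j / 2 ^ k \<le> real i / 2 ^ l" "real (i + 1) / 2 ^ l \<le> real (j + 1) / 2 ^ k"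
    by (simp_all only: divide_right_mono zero_le_power zero_le_numeral)
  then show ?thesis
    unfolding dyadic_interval_def by auto
qed

lemma dyadic_interval_nonempty: "dyadic_interval k j \<noteq> {}"
  by (simp add: dyadic_interval_def divide_strict_right_mono)

text \<open>Since \<alpha> is nonempty, two intervals containing it share a point and are therefore
  nested, the one of lower generation being the larger.\<close>

lemma finite_forest_dyadic_tree: "finite_forest (dyadic_tree N)"
proof
  have "dyadic_tree N = (\<Union>k\<le>N. dyadic_interval k ` {..<2 ^ k})"
    unfolding dyadic_tree_def by auto
  then show "finite (dyadic_tree N)"
    by simp
next
  fix \<alpha> \<beta> \<gamma> :: "real set"
  assume T: "\<alpha> \<in> dyadic_tree N" "\<beta> \<in> dyadic_tree N" "\<gamma> \<in> dyadic_tree N"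
    and sub: "\<alpha> \<subseteq> \<beta>" "\<alpha> \<subseteq> \<gamma>"
  from T obtain k j l i where eq: "\<beta> = dyadic_interval k j" "\<gamma> = dyadic_interval l i"
    unfolding dyadic_tree_def by blast
  from T(1) obtain x where "x \<in> \<alpha>"
    unfolding dyadic_tree_def using dyadic_interval_nonempty by blast
  then have "x \<in> dyadic_interval k j" "x \<in> dyadic_interval l i"
    using sub eq by auto
  then show "\<beta> \<subseteq> \<gamma> \<or> \<gamma> \<subseteq> \<beta>"
    unfolding eq using dyadic_interval_subset by (cases "k \<le> l") auto
qed

theorem theorem0p1:
  shows "(\<forall>C :: real. \<exists>C' > 0. \<forall>N \<mu>. tree_measure N \<mu> \<longrightarrow>
            hardy_bounded N \<mu> C \<longrightarrow> carleson_condition N \<mu> C')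
       \<and> (\<forall>C' :: real. \<exists>C > 0. \<forall>N \<mu>. tree_measure N \<mu> \<longrightarrow>
            carleson_condition N \<mu> C' \<longrightarrow> hardy_bounded N \<mu> C)"
proof (intro conjI allI)
  fix C :: real
  show "\<exists>C' > 0. \<forall>N \<mu>. tree_measure N \<mu> \<longrightarrow> hardy_bounded N \<mu> C \<longrightarrow> carleson_condition N \<mu> C'"
  \<comment> \<open>\<open>C\<close> is an arbitrary real; the maximum makes the constant positive
    and only weakens the hypothesis, as its right-hand sum is nonnegative.\<close>
  proof (intro exI[of _ "max C 1"] conjI allI impI)
    fix N \<mu>
    assume \<mu>: "tree_measure N \<mu>" and bounded: "hardy_bounded N \<mu> C"
    interpret finite_forest "dyadic_tree N" by (rule finite_forest_dyadic_tree)
    have "(\<Sum>\<alpha>\<in>dyadic_tree N. (sum_above \<phi> \<alpha>)\<^sup>2 * \<mu> \<alpha>)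
        \<le> max C 1 * (\<Sum>\<beta>\<in>dyadic_tree N. (\<phi> \<beta>)\<^sup>2)" for \<phi>
    proof -
      have "(\<Sum>\<alpha>\<in>dyadic_tree N. (sum_above \<phi> \<alpha>)\<^sup>2 * \<mu> \<alpha>) \<le> C * (\<Sum>\<beta>\<in>dyadic_tree N. (\<phi> \<beta>)\<^sup>2)"
        using bounded unfolding hardy_bounded_def hardy_def sum_above_def by simp
      also have "\<dots> \<le> max C 1 * (\<Sum>\<beta>\<in>dyadic_tree N. (\<phi> \<beta>)\<^sup>2)"
        by (intro mult_right_mono sum_nonneg) auto
      finally show ?thesis .
    qed
    then have "sum_below (\<lambda>\<beta>. (sum_below \<mu> \<beta>)\<^sup>2) \<rho> \<le> max C 1 * sum_below \<mu> \<rho>" for \<rho>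
      using \<mu> by (intro carleson_if_bounded) (auto simp: tree_measure_def)
    then show "carleson_condition N \<mu> (max C 1)"
      unfolding carleson_condition_def sum_below_def by simp
  qed simp
next
  fix C' :: real
  show "\<exists>C > 0. \<forall>N \<mu>. tree_measure N \<mu> \<longrightarrow> carleson_condition N \<mu> C' \<longrightarrow> hardy_bounded N \<mu> C"
  \<comment> \<open>The 4 is the square of the 2 in \<open>v \<beta> \<le> 2 * \<phi> \<beta> *
    sum_above \<phi> \<beta>\<close>.\<close>
  proof (intro exI[of _ "4 * max C' 1"] conjI allI impI)
    fix N \<mu>
    assume \<mu>: "tree_measure N \<mu>" and carleson: "carleson_condition N \<mu> C'"
    interpret finite_forest "dyadic_tree N" by (rule finite_forest_dyadic_tree)
    have "sum_below (\<lambda>\<beta>. (sum_below \<mu> \<beta>)\<^sup>2) \<rho> \<le> max C' 1 * sum_below \<mu> \<rho>"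
      if "\<rho> \<in> dyadic_tree N" for \<rho>
    proof -
      have "sum_below (\<lambda>\<beta>. (sum_below \<mu> \<beta>)\<^sup>2) \<rho> \<le> C' * sum_below \<mu> \<rho>"
        using carleson that unfolding carleson_condition_def sum_below_def by simp
      also have "\<dots> \<le> max C' 1 * sum_below \<mu> \<rho>"
        using \<mu> unfolding sum_below_def tree_measure_def
        by (intro mult_right_mono sum_nonneg) auto
      finally show ?thesis .
    qed
    then have "(\<Sum>\<alpha>\<in>dyadic_tree N. (sum_above \<phi> \<alpha>)\<^sup>2 * \<mu> \<alpha>)
        \<le> 4 * max C' 1 * (\<Sum>\<beta>\<in>dyadic_tree N. (\<phi> \<beta>)\<^sup>2)" for \<phi>
      using \<mu> by (intro bounded_if_carleson) (auto simp: tree_measure_def)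
    then show "hardy_bounded N \<mu> (4 * max C' 1)"
      unfolding hardy_bounded_def hardy_def sum_above_def by simp
  qed simp
qed

end
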